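(* Let the channel power budgets $q_1,\dots,q_M$ be given, fix $m\in\{1,\dots,M\}$, and put $$A_{l,m}=2^{R_{l,m}^{\min}/B_c}\ (l=1,2),\quad \Upsilon_m=\frac{A_{2,m}(A_{1,m}-1)}{\Gamma_{1,m}}+\frac{A_{2,m}-1}{\Gamma_{2,m}},\quad \Xi_m=\frac{\Gamma_{2,m}q_m-A_{2,m}+1}{A_{2,m}\Gamma_{2,m}}.$$ Suppose that $\Gamma_{1,m}\ge\Gamma_{2,m}$, $A_{2,m}\ge2$ and $q_m\ge\Upsilon_m$. Then the optimal solution to $$\max_{p_{1,m},p_{2,m}}\ \frac{R_{1,m}+R_{2,m}}{P_T+\sum_{k=1}^Mq_k}\quad\text{s.t.}\quad 0\le p_{1,m}\le p_{2,m},\ p_{1,m}+p_{2,m}=q_m,\ R_{1,m}\ge R_{1,m}^{\min},\ R_{2,m}\ge R_{2,m}^{\min},$$ where $R_{1,m}=B_c\log(1+p_{1,m}\Gamma_{1,m})$ and $R_{2,m}=B_c\log\left(1+\frac{p_{2,m}\Gamma_{2,m}}{p_{1,m}\Gamma_{2,m}+1}\right)$, is $p_{1,m}^\star=\Xi_m$ and $p_{2,m}^\star=q_m-p_{1,m}^\star$.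
   Context: Setting: downlink NOMA (non-orthogonal multiple access) with $M$ channels of bandwidth $B_c>0$, two users per channel; $\Gamma_{l,m}>0$ is the channel-to-noise ratio of user $l$ on channel $m$, $p_{l,m}$ its power, $R_{l,m}$ its rate, $R_{l,m}^{\min}$ its quality-of-service threshold, $q_m$ the power budget of channel $m$, and $P_T$ the circuit power consumption. $\log$ is the base-2 logarithm.
   Formalization: The stated point is proved optimal, and the only optimum when Γ_{1,m}>Γ_{2,m}; if Γ_{1,m}=Γ_{2,m} uniqueness can fail and is not claimed. The rate thresholds, the channel budgets q_k and the circuit power P_T are taken to be nonnegative. *)

theory Defs
  imports Complex_Main
begin

text \<open>Two-user downlink NOMA. Two-index quantities \<open>x l m\<close> have user index \<open>l \<in> {1, 2}\<close> and channel
  index \<open>m \<in> {1..M}\<close>; a power allocation on a single channel is a pair \<open>(p1, p2)\<close>.\<close>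

definition rate1 :: "real \<Rightarrow> (nat \<Rightarrow> nat \<Rightarrow> real) \<Rightarrow> nat \<Rightarrow> real \<times> real \<Rightarrow> real" where
  "rate1 Bc \<Gamma> m = (\<lambda>(p1, p2). Bc * log 2 (1 + p1 * \<Gamma> 1 m))"

definition rate2 :: "real \<Rightarrow> (nat \<Rightarrow> nat \<Rightarrow> real) \<Rightarrow> nat \<Rightarrow> real \<times> real \<Rightarrow> real" where
  "rate2 Bc \<Gamma> m = (\<lambda>(p1, p2). Bc * log 2 (1 + p2 * \<Gamma> 2 m / (p1 * \<Gamma> 2 m + 1)))"

definition qos_factor :: "real \<Rightarrow> (nat \<Rightarrow> nat \<Rightarrow> real) \<Rightarrow> nat \<Rightarrow> nat \<Rightarrow> real" where
  "qos_factor Bc Rmin l m = 2 powr (Rmin l m / Bc)"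

definition Upsilon ::
  "real \<Rightarrow> (nat \<Rightarrow> nat \<Rightarrow> real) \<Rightarrow> (nat \<Rightarrow> nat \<Rightarrow> real) \<Rightarrow> nat \<Rightarrow> real" where
  "Upsilon Bc \<Gamma> Rmin m =
     qos_factor Bc Rmin 2 m * (qos_factor Bc Rmin 1 m - 1) / \<Gamma> 1 m
     + (qos_factor Bc Rmin 2 m - 1) / \<Gamma> 2 m"

definition Xi ::
  "real \<Rightarrow> (nat \<Rightarrow> nat \<Rightarrow> real) \<Rightarrow> (nat \<Rightarrow> nat \<Rightarrow> real) \<Rightarrow> (nat \<Rightarrow> real) \<Rightarrow> nat \<Rightarrow> real" where
  "Xi Bc \<Gamma> Rmin q m =
     (\<Gamma> 2 m * q m - qos_factor Bc Rmin 2 m + 1) / (qos_factor Bc Rmin 2 m * \<Gamma> 2 m)"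

definition energy_efficiency ::
  "nat \<Rightarrow> real \<Rightarrow> real \<Rightarrow> (nat \<Rightarrow> nat \<Rightarrow> real) \<Rightarrow> (nat \<Rightarrow> real) \<Rightarrow> nat \<Rightarrow> real \<times> real \<Rightarrow> real" where
  "energy_efficiency M Bc PT \<Gamma> q m p =
     (rate1 Bc \<Gamma> m p + rate2 Bc \<Gamma> m p) / (PT + (\<Sum>k=1..M. q k))"

definition feasible ::
  "real \<Rightarrow> (nat \<Rightarrow> nat \<Rightarrow> real) \<Rightarrow> (nat \<Rightarrow> nat \<Rightarrow> real) \<Rightarrow> (nat \<Rightarrow> real) \<Rightarrow> nat \<Rightarrow> real \<times> real \<Rightarrow> bool"
where
  "feasible Bc \<Gamma> Rmin q m p \<longleftrightarrow>
     0 \<le> fst p \<and> fst p \<le> snd p \<and> fst p + snd p = q m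
     \<and> rate1 Bc \<Gamma> m p \<ge> Rmin 1 m \<and> rate2 Bc \<Gamma> m p \<ge> Rmin 2 m"

definition optimal_solution ::
  "nat \<Rightarrow> real \<Rightarrow> real \<Rightarrow> (nat \<Rightarrow> nat \<Rightarrow> real) \<Rightarrow> (nat \<Rightarrow> nat \<Rightarrow> real) \<Rightarrow> (nat \<Rightarrow> real) \<Rightarrow> nat
   \<Rightarrow> real \<times> real \<Rightarrow> bool" where
  "optimal_solution M Bc PT \<Gamma> Rmin q m p \<longleftrightarrow>
     is_arg_max (energy_efficiency M Bc PT \<Gamma> q m) (feasible Bc \<Gamma> Rmin q m) p"

end

theory Submission
  imports Defs
begin

text \<open>On the line \<open>p1 + p2 = q\<close> the signal-to-interference ratio of user 2 satisfies
  \<open>1 + p2 \<Gamma>2 / (p1 \<Gamma>2 + 1) = (1 + q \<Gamma>2) / (1 + p1 \<Gamma>2)\<close>. Hence its rate constraint is the upper bound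
  \<open>p1 \<le> \<Xi>\<close>, while the sum rate is, up to a constant, the logarithm of
  \<open>(1 + p1 \<Gamma>1) / (1 + p1 \<Gamma>2)\<close>, which is increasing in \<open>p1\<close> as \<open>\<Gamma>1 \<ge> \<Gamma>2\<close>. So the optimum is at
  \<open>p1 = \<Xi>\<close>; the bound \<open>q \<ge> \<Upsilon>\<close> says exactly that \<open>\<Xi>\<close> meets the rate constraint of user 1, and
  \<open>A2 \<ge> 2\<close> ensures \<open>\<Xi> \<le> q / 2\<close>.\<close>

lemma le_mult_log_iff:
  fixes B R y :: real
  assumes "B > 0" "y > 0"
  shows "R \<le> B * log 2 y \<longleftrightarrow> 2 powr (R / B) \<le> y"
proof -
  have "R \<le> B * log 2 y \<longleftrightarrow> R / B \<le> log 2 y"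
    using assms by (simp add: field_simps)
  also have "\<dots> \<longleftrightarrow> 2 powr (R / B) \<le> y"
    using assms by (simp add: le_log_iff)
  finally show ?thesis .
qed

lemma rate2_eq:
  assumes "\<Gamma> 2 m > 0" "x \<ge> 0"
  shows "rate2 Bc \<Gamma> m (x, q - x) = Bc * log 2 ((1 + q * \<Gamma> 2 m) / (1 + x * \<Gamma> 2 m))"
proof -
  have "1 + x * \<Gamma> 2 m > 0"
    using assms by (simp add: add_pos_nonneg)
  then have "1 + (q - x) * \<Gamma> 2 m / (x * \<Gamma> 2 m + 1) = (1 + q * \<Gamma> 2 m) / (1 + x * \<Gamma> 2 m)"
    by (simp add: field_simps)
  then show ?thesis
    by (simp add: rate2_def)
qed

lemma rate1_ge_iff:
  assumes "Bc > 0" "\<Gamma> 1 m > 0" "x \<ge> 0"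
  shows "rate1 Bc \<Gamma> m (x, y) \<ge> Rmin 1 m \<longleftrightarrow> (qos_factor Bc Rmin 1 m - 1) / \<Gamma> 1 m \<le> x"
proof -
  have "1 + x * \<Gamma> 1 m > 0"
    using assms by (simp add: add_pos_nonneg)
  then show ?thesis
    using assms
    by (auto simp: rate1_def le_mult_log_iff qos_factor_def pos_divide_le_eq)
qed

lemma rate2_ge_iff:
  assumes "Bc > 0" "\<Gamma> 2 m > 0" "x \<ge> 0" "q m \<ge> 0"
  shows "rate2 Bc \<Gamma> m (x, q m - x) \<ge> Rmin 2 m \<longleftrightarrow> x \<le> Xi Bc \<Gamma> Rmin q m"
proof -
  let ?A = "qos_factor Bc Rmin 2 m"
  have pos: "1 + x * \<Gamma> 2 m > 0" "1 + q m * \<Gamma> 2 m > 0" "?A > 0"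
    using assms by (simp_all add: add_pos_nonneg qos_factor_def)
  then have "rate2 Bc \<Gamma> m (x, q m - x) \<ge> Rmin 2 m
      \<longleftrightarrow> ?A \<le> (1 + q m * \<Gamma> 2 m) / (1 + x * \<Gamma> 2 m)"
    using assms by (simp add: rate2_eq le_mult_log_iff qos_factor_def)
  also have "\<dots> \<longleftrightarrow> x * (?A * \<Gamma> 2 m) \<le> \<Gamma> 2 m * q m - ?A + 1"
    using pos by (simp add: pos_le_divide_eq algebra_simps)
  also have "\<dots> \<longleftrightarrow> x \<le> Xi Bc \<Gamma> Rmin q m"
    using pos assms by (simp add: Xi_def pos_le_divide_eq)
  finally show ?thesis .
qed

text \<open>This turns the problem in two powers into one over an interval for \<open>x\<close>. On
  the line \<open>y = q m - x\<close> the ordering \<open>x \<le> y\<close> becomes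
  \<open>x \<le> q m / 2\<close>, and each rate constraint bounds \<open>x\<close> from one
  side.\<close>

lemma feasible_iff:
  assumes "Bc > 0" "\<Gamma> 1 m > 0" "\<Gamma> 2 m > 0" "q m \<ge> 0"
  shows "feasible Bc \<Gamma> Rmin q m (x, y) \<longleftrightarrow>
    y = q m - x \<and> 0 \<le> x \<and> x \<le> q m / 2
    \<and> (qos_factor Bc Rmin 1 m - 1) / \<Gamma> 1 m \<le> x \<and> x \<le> Xi Bc \<Gamma> Rmin q m"
proof (cases "y = q m - x \<and> 0 \<le> x")
  case True
  then show ?thesis
    using rate1_ge_iff[of Bc \<Gamma> m x Rmin "q m - x"] rate2_ge_iff[of Bc \<Gamma> m x q Rmin] assms
    by (auto simp: feasible_def)
next
  case False
  then show ?thesis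
    by (auto simp: feasible_def)
qed

text \<open>Multiplying \<open>Upsilon \<le> q m\<close> by \<open>\<Gamma> 2 m\<close> and solving
  for the least power of user 1 gives the first bound. For the second, write \<open>A\<close> for
  the factor of user 2: \<open>Xi\<close> equals
  \<open>q m / A - (A - 1) / (A * \<Gamma> 2 m)\<close>, which is at most
  \<open>q m / A\<close>.\<close>

lemma Xi_bounds:
  assumes "\<Gamma> 1 m > 0" "\<Gamma> 2 m > 0" "q m \<ge> 0"
    and A2: "qos_factor Bc Rmin 2 m \<ge> 2" and q: "q m \<ge> Upsilon Bc \<Gamma> Rmin m"
  shows "(qos_factor Bc Rmin 1 m - 1) / \<Gamma> 1 m \<le> Xi Bc \<Gamma> Rmin q m"
    and "Xi Bc \<Gamma> Rmin q m \<le> q m / 2"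
proof -
  let ?A = "qos_factor Bc Rmin 2 m"
  define c where "c = (qos_factor Bc Rmin 1 m - 1) / \<Gamma> 1 m"
  have "?A * c + (?A - 1) / \<Gamma> 2 m \<le> q m"
    using q by (simp add: Upsilon_def c_def)
  then have "(?A * c + (?A - 1) / \<Gamma> 2 m) * \<Gamma> 2 m \<le> q m * \<Gamma> 2 m"
    using assms by (intro mult_right_mono) auto
  moreover have "(?A * c + (?A - 1) / \<Gamma> 2 m) * \<Gamma> 2 m = c * (?A * \<Gamma> 2 m) + (?A - 1)"
    using \<open>\<Gamma> 2 m > 0\<close> by (simp add: field_simps)
  ultimately have "c * (?A * \<Gamma> 2 m) \<le> \<Gamma> 2 m * q m - ?A + 1"
    by (simp add: mult_ac)
  then have "c \<le> Xi Bc \<Gamma> Rmin q m"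
    using assms by (simp add: Xi_def pos_le_divide_eq)
  then show "(qos_factor Bc Rmin 1 m - 1) / \<Gamma> 1 m \<le> Xi Bc \<Gamma> Rmin q m"
    by (simp add: c_def)
  have "2 * (\<Gamma> 2 m * q m) \<le> ?A * (\<Gamma> 2 m * q m)"
    using assms by (intro mult_right_mono) auto
  then have "\<Gamma> 2 m * q m - ?A + 1 \<le> q m / 2 * (?A * \<Gamma> 2 m)"
    using A2 by (simp add: mult_ac)
  then show "Xi Bc \<Gamma> Rmin q m \<le> q m / 2"
    using assms by (simp add: Xi_def pos_divide_le_eq)
qed

text \<open>The logarithms are regrouped so that \<open>x\<close> occurs in a single ratio
  only.\<close>

lemma sum_rate_eq:
  assumes "\<Gamma> 1 m > 0" "\<Gamma> 2 m > 0" "x \<ge> 0" "q \<ge> 0"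
  shows "rate1 Bc \<Gamma> m (x, q - x) + rate2 Bc \<Gamma> m (x, q - x)
    = Bc * (log 2 (1 + q * \<Gamma> 2 m) + log 2 ((1 + x * \<Gamma> 1 m) / (1 + x * \<Gamma> 2 m)))"
proof -
  have "1 + x * \<Gamma> 1 m > 0" "1 + x * \<Gamma> 2 m > 0" "1 + q * \<Gamma> 2 m > 0"
    using assms by (simp_all add: add_pos_nonneg)
  then show ?thesis
    using assms by (simp add: rate2_eq rate1_def log_divide algebra_simps)
qed

text \<open>After cross-multiplication the two sides differ by \<open>(y - x) * (a - b)\<close>. The
  strict form serves uniqueness.\<close>

lemma ratio_mono:
  fixes a b x y :: real
  assumes "0 < b" "b \<le> a" "0 \<le> x" "x \<le> y"
  shows "(1 + x * a) / (1 + x * b) \<le> (1 + y * a) / (1 + y * b)"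
    and "b < a \<Longrightarrow> x < y \<Longrightarrow> (1 + x * a) / (1 + x * b) < (1 + y * a) / (1 + y * b)"
proof -
  have pos: "1 + x * b > 0" "1 + y * b > 0"
    using assms by (simp_all add: add_pos_nonneg)
  have diff: "(1 + y * a) * (1 + x * b) - (1 + x * a) * (1 + y * b) = (y - x) * (a - b)"
    by (simp add: algebra_simps)
  have "(y - x) * (a - b) \<ge> 0"
    using assms by simp
  then have "(1 + x * a) * (1 + y * b) \<le> (1 + y * a) * (1 + x * b)"
    using diff by linarith
  then show "(1 + x * a) / (1 + x * b) \<le> (1 + y * a) / (1 + y * b)"
    using pos by (simp add: frac_le_eq divide_le_0_iff)
  assume "b < a" "x < y"
  then have "(y - x) * (a - b) > 0"
    by simp
  then have "(1 + x * a) * (1 + y * b) < (1 + y * a) * (1 + x * b)"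
    using diff by linarith
  then show "(1 + x * a) / (1 + x * b) < (1 + y * a) / (1 + y * b)"
    using pos by (simp add: frac_less_eq divide_less_0_iff)
qed

text \<open>The denominator does not depend on the split of \<open>q m\<close>, so monotonicity is
  inherited from the ratio through the logarithm.\<close>

lemma energy_efficiency_mono:
  assumes "Bc > 0" "\<Gamma> 2 m > 0" "\<Gamma> 2 m \<le> \<Gamma> 1 m" "q m \<ge> 0"
    and P: "PT + (\<Sum>k=1..M. q k) > 0"
    and "0 \<le> x" "x \<le> y"
  shows "energy_efficiency M Bc PT \<Gamma> q m (x, q m - x)
      \<le> energy_efficiency M Bc PT \<Gamma> q m (y, q m - y)"
    and "\<Gamma> 2 m < \<Gamma> 1 m \<Longrightarrow> x < y \<Longrightarrow> energy_efficiency M Bc PT \<Gamma> q m (x, q m - x)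
      < energy_efficiency M Bc PT \<Gamma> q m (y, q m - y)"
proof -
  let ?r = "\<lambda>x. (1 + x * \<Gamma> 1 m) / (1 + x * \<Gamma> 2 m)"
  have eq: "energy_efficiency M Bc PT \<Gamma> q m (z, q m - z)
      = Bc * (log 2 (1 + q m * \<Gamma> 2 m) + log 2 (?r z)) / (PT + (\<Sum>k=1..M. q k))"
    if "z \<ge> 0" for z
    using assms that by (simp add: energy_efficiency_def sum_rate_eq)
  have pos: "?r x > 0" "?r y > 0"
    using assms by (simp_all add: add_pos_nonneg)
  have "?r x \<le> ?r y"
    using assms by (intro ratio_mono)
  then have "log 2 (?r x) \<le> log 2 (?r y)"
    using pos by simp
  then show "energy_efficiency M Bc PT \<Gamma> q m (x, q m - x)
      \<le> energy_efficiency M Bc PT \<Gamma> q m (y, q m - y)"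
    unfolding eq[OF \<open>0 \<le> x\<close>] eq[OF order_trans[OF \<open>0 \<le> x\<close> \<open>x \<le> y\<close>]]
    using P \<open>Bc > 0\<close> by (intro divide_right_mono mult_left_mono) auto
  assume "\<Gamma> 2 m < \<Gamma> 1 m" "x < y"
  then have "?r x < ?r y"
    using assms by (intro ratio_mono)
  then have "log 2 (?r x) < log 2 (?r y)"
    using pos by simp
  then show "energy_efficiency M Bc PT \<Gamma> q m (x, q m - x)
      < energy_efficiency M Bc PT \<Gamma> q m (y, q m - y)"
    unfolding eq[OF \<open>0 \<le> x\<close>] eq[OF order_trans[OF \<open>0 \<le> x\<close> \<open>x \<le> y\<close>]]
    using P \<open>Bc > 0\<close> by (intro divide_strict_right_mono mult_strict_left_mono) auto
qed

text \<open>Uniqueness is claimed for \<open>\<Gamma> 1 m > \<Gamma> 2 m\<close> only: with equal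
  gains the ratio is constantly 1 and every feasible point is optimal.\<close>

theorem proposition5:
  fixes M m :: nat
    and Bc PT :: real
    and \<Gamma> Rmin :: "nat \<Rightarrow> nat \<Rightarrow> real"
    and q :: "nat \<Rightarrow> real"
  assumes "Bc > 0"
    and "PT \<ge> 0"
    and "\<forall>l\<in>{1, 2}. \<forall>k\<in>{1..M}. \<Gamma> l k > 0"
    and "\<forall>l\<in>{1, 2}. \<forall>k\<in>{1..M}. Rmin l k \<ge> 0"
    and "\<forall>k\<in>{1..M}. q k \<ge> 0"
    and "m \<in> {1..M}"
    and "\<Gamma> 1 m \<ge> \<Gamma> 2 m"
    and "qos_factor Bc Rmin 2 m \<ge> 2"
    and "q m \<ge> Upsilon Bc \<Gamma> Rmin m"
  shows "optimal_solution M Bc PT \<Gamma> Rmin q m (Xi Bc \<Gamma> Rmin q m, q m - Xi Bc \<Gamma> Rmin q m)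
    \<and> (\<Gamma> 1 m > \<Gamma> 2 m \<longrightarrow>
        (\<forall>p. optimal_solution M Bc PT \<Gamma> Rmin q m p
             \<longrightarrow> p = (Xi Bc \<Gamma> Rmin q m, q m - Xi Bc \<Gamma> Rmin q m)))"
proof -
  let ?Xi = "Xi Bc \<Gamma> Rmin q m"
  let ?E = "energy_efficiency M Bc PT \<Gamma> q m" and ?F = "feasible Bc \<Gamma> Rmin q m"
  have pos: "\<Gamma> 1 m > 0" "\<Gamma> 2 m > 0" "q m \<ge> 0" and "Rmin 1 m \<ge> 0"
    using assms(3-6) by auto
  then have "qos_factor Bc Rmin 1 m \<ge> 1"
    using \<open>Bc > 0\<close> by (simp add: qos_factor_def ge_one_powr_ge_zero)
  then have c: "(qos_factor Bc Rmin 1 m - 1) / \<Gamma> 1 m \<ge> 0"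
    using pos by simp
  note Xi = Xi_bounds[of \<Gamma> m q Bc Rmin, OF pos assms(8,9)]
  \<comment> \<open>As \<open>PT\<close> may be 0, positivity of the total power has to come from
    \<open>q m\<close>. A zero budget would make \<open>Xi\<close> negative, although it is at least
    the nonnegative minimal power of user 1.\<close>
  have q_pos: "q m > 0"
  proof (rule ccontr)
    assume "\<not> q m > 0"
    then have "q m = 0"
      using pos by simp
    then have "?Xi < 0"
      using assms(8) pos by (simp add: Xi_def divide_neg_pos)
    then show False
      using c Xi by linarith
  qed
  have "q m \<le> (\<Sum>k=1..M. q k)"
    using assms(5,6) by (intro member_le_sum) auto
  then have P: "PT + (\<Sum>k=1..M. q k) > 0"
    using q_pos \<open>PT \<ge> 0\<close> by linarith
  note mono = energy_efficiency_mono[of Bc \<Gamma> m q PT M,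
      OF \<open>Bc > 0\<close> pos(2) assms(7) pos(3) P]
  note feas = feasible_iff[of Bc \<Gamma> m q Rmin, OF \<open>Bc > 0\<close> pos]
  have F_Xi: "?F (?Xi, q m - ?Xi)"
    using Xi c by (auto simp: feas)
  \<comment> \<open>Feasibility forces the first power to be at most \<open>?Xi\<close>, so
    monotonicity compares \<open>p\<close> with the endpoint.\<close>
  moreover have "?E p \<le> ?E (?Xi, q m - ?Xi)" if "?F p" for p
    using that mono(1) by (cases p) (auto simp: feas)
  ultimately have "optimal_solution M Bc PT \<Gamma> Rmin q m (?Xi, q m - ?Xi)"
    by (force simp: optimal_solution_def is_arg_max_def not_less)
  moreover have "p = (?Xi, q m - ?Xi)"
    if "\<Gamma> 1 m > \<Gamma> 2 m" and "optimal_solution M Bc PT \<Gamma> Rmin q m p" for p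
  proof -
    have p: "?F p" "\<not> ?E p < ?E (?Xi, q m - ?Xi)"
      using that(2) F_Xi by (auto simp: optimal_solution_def is_arg_max_def)
    obtain x where x: "p = (x, q m - x)" "0 \<le> x" "x \<le> ?Xi"
      using p(1) by (cases p) (auto simp: feas)
    \<comment> \<open>Otherwise the feasible endpoint would be strictly better than the optimal
      \<open>p\<close>.\<close>
    then have "\<not> x < ?Xi"
      using mono(2)[OF x(2,3) that(1)] p(2) unfolding x(1) by blast
    with x(3) have "x = ?Xi"
      by linarith
    then show ?thesis
      using x(1) by simp
  qed
  ultimately show ?thesis
    by blast
qed

end
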